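(* Let $\hat k$ be a quadratic extension of $k$. Let $X\in\mathfrak{sl}(2,k)$ be such that $-\det X\in(\mathrm{Im}\,\hat k^* )^2$ and $\nu_{\det X}(X)=[2]$. Let $q,\bar q\in\mathrm{Im}\,\hat k^*$ be the eigenvalues of $X$ and let $\phi$ and $\bar\phi$ be corresponding eigenvectors in $(\hat k^2)^*$ (so $X\cdot\phi=q\phi$ and $X\cdot\bar\phi=\bar q\bar\phi$). (i) There exists $a\in\hat k^*$ such that $a\bar a\,\Omega(\bar\phi,\phi)^3=q$. (ii) For such an $a$, $$\mu^{-1}(X)=\{ua\phi^3+\bar u\bar a\,\bar\phi^3:\ u\in\hat k^*\text{ and }u\bar u=1\}.$$
   Context: $k$ is a field of characteristic different from $2$ and $3$; $x,y$ is the standard coordinate basis of $(k^2)^*$; $S^3((k^2)^* )=\{ax^3+3bx^2y+3cxy^2+dy^3: a,b,c,d\in k\}$. The moment map $\mu:S^3((k^2)^* )\to\mathfrak{sl}(2,k)$ is $$\mu(ax^3+3bx^2y+3cxy^2+dy^3)=\begin{pmatrix} ad-bc & 2(bd-c^2)\\ 2(b^2-ac) & -(ad-bc)\end{pmatrix}.$$ $(k^2)^*$ carries the symplectic form $\Omega(ax+by,a'x+b'y)=ab'-ba'$ (also denoted $\Omega$ after base extension to $\hat k$), and $\mathfrak{sl}(2,k)$ acts on $(k^2)^*$, and after base extension on $(\hat k^2)^*$, by $\begin{pmatrix}\alpha&\beta\\ \gamma&-\alpha\end{pmatrix}\cdot x=-\alpha x-\beta y$, $\begin{pmatrix}\alpha&\beta\\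 \gamma&-\alpha\end{pmatrix}\cdot y=-\gamma x+\alpha y$; eigenvectors are with respect to this action. For $\Delta\in k$, $k^*_\Delta=\{z\in k^*:\exists\, a,b\in k,\ z=a^2+b^2\Delta\}$, a subgroup of $k^*$; for $0\neq X\in\mathfrak{sl}(2,k)$ with $\det X=\Delta$, $\nu_\Delta(X)=[\Omega(v,X\cdot v)]\in k^*/k^*_\Delta$ for any nonzero $v\in(k^2)^*$ which is not an eigenvector of $X$ (independent of $v$). $z\mapsto\bar z$ denotes the action of the generator of $\mathrm{Gal}(\hat k/k)$ on $\hat k$ and on any space obtained by base extension from $k$; $S^3((k^2)^* )$ is identified with the fixed points of conjugation in $S^3((\hat k^2)^* )$. $\mathrm{Im}\,\hat k^*=\{\lambda\in\hat k:\lambda\ne0,\ \bar\lambda=-\lambda\}$ and $(\mathrm{Im}\,\hat k^* )^2=\{q^2:q\in\mathrm{Im}\,\hat k^*\}\subseteq k^*$. *)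

theory Defs
  imports "HOL-Analysis.Analysis" "HOL-Computational_Algebra.Computational_Algebra"
begin

section \<open>Binary forms\<close>

text \<open>
  Linear and cubic forms on the plane are elements of the polynomial ring \<open>k[x][y]\<close>, represented
  as \<open>'a poly poly\<close> with \<open>y\<close> the outer and \<open>x\<close> the inner variable. Products and powers
  of forms are those of this ring.
\<close>

definition scal :: "'a::field \<Rightarrow> 'a poly poly"
  where "scal c = [:[:c:]:]"

definition xform :: "'a::field poly poly"
  where "xform = [:[:0, 1:]:]"

definition yform :: "'a::field poly poly"
  where "yform = [:0, 1:]"

definition xy_coeff :: "'a::field poly poly \<Rightarrow> nat \<Rightarrow> nat \<Rightarrow> 'a"
  where "xy_coeff f i j = coeff (coeff f j) i"

definition linear_form :: "'a::field \<Rightarrow> 'a \<Rightarrow> 'a poly poly"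
  where "linear_form a b = scal a * xform + scal b * yform"

definition linear_forms :: "'a::field poly poly set"
  where "linear_forms = {linear_form a b | a b. True}"

definition cubic_form :: "'a::field \<Rightarrow> 'a \<Rightarrow> 'a \<Rightarrow> 'a \<Rightarrow> 'a poly poly"
  where "cubic_form a b c d =
    scal a * xform ^ 3 + scal (3 * b) * xform ^ 2 * yform +
    scal (3 * c) * xform * yform ^ 2 + scal d * yform ^ 3"

definition cubic_forms :: "'a::field poly poly set"
  where "cubic_forms = {cubic_form a b c d | a b c d. True}"

definition Omega :: "'a::field poly poly \<Rightarrow> 'a poly poly \<Rightarrow> 'a"
  where "Omega v w = xy_coeff v 1 0 * xy_coeff w 0 1 - xy_coeff v 0 1 * xy_coeff w 1 0"

section \<open>The Lie algebra, its action on linear forms, and the moment map\<close>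

definition sl2 :: "('a::field ^ 2 ^ 2) set"
  where "sl2 = {X. trace X = 0}"

definition sl2_act :: "'a::field ^ 2 ^ 2 \<Rightarrow> 'a poly poly \<Rightarrow> 'a poly poly"
  where "sl2_act X v =
    scal (xy_coeff v 1 0) * linear_form (- (X$1$1)) (- (X$1$2)) +
    scal (xy_coeff v 0 1) * linear_form (- (X$2$1)) (X$1$1)"

definition eigenvector :: "'a::field ^ 2 ^ 2 \<Rightarrow> 'a \<Rightarrow> 'a poly poly \<Rightarrow> bool"
  where "eigenvector X l v \<longleftrightarrow> v \<in> linear_forms \<and> v \<noteq> 0 \<and> sl2_act X v = scal l * v"

text \<open>The middle coefficients are divided by 3 because the coordinates on the space of cubics are
  \<open>a x\<^sup>3 + 3 b x\<^sup>2 y + 3 c x y\<^sup>2 + d y\<^sup>3\<close>.\<close>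

definition moment :: "'a::field poly poly \<Rightarrow> 'a ^ 2 ^ 2"
  where "moment f =
    (let a = xy_coeff f 3 0; b = xy_coeff f 2 1 / 3; c = xy_coeff f 1 2 / 3; d = xy_coeff f 0 3
     in vector [vector [a * d - b * c, 2 * (b * d - c\<^sup>2)],
                vector [2 * (b\<^sup>2 - a * c), - (a * d - b * c)]])"

section \<open>The invariant \<open>\<nu>\<close>\<close>

definition kstar :: "'a::field \<Rightarrow> 'a set"
  where "kstar \<Delta> = {z. z \<noteq> 0 \<and> (\<exists>a b. z = a\<^sup>2 + b\<^sup>2 * \<Delta>)}"

text \<open>The class of \<open>z\<close> in the quotient of the multiplicative group by \<open>kstar \<Delta>\<close>, as a coset.\<close>

definition kstar_class :: "'a::field \<Rightarrow> 'a \<Rightarrow> 'a set"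
  where "kstar_class \<Delta> z = (\<lambda>w. z * w) ` kstar \<Delta>"

text \<open>Independence of the choice of \<open>v\<close> is lemma \<open>nu_eq\<close> below.\<close>

definition nu :: "'a::field \<Rightarrow> 'a ^ 2 ^ 2 \<Rightarrow> 'a set"
  where "nu \<Delta> X =
    (let v = SOME v. v \<in> linear_forms \<and> v \<noteq> 0 \<and> (\<nexists>l. eigenvector X l v)
     in kstar_class \<Delta> (Omega v (sl2_act X v)))"

section \<open>Quadratic extensions and conjugation\<close>

definition field_hom :: "('a::field \<Rightarrow> 'b::field) \<Rightarrow> bool"
  where "field_hom h \<longleftrightarrow>
    h 1 = 1 \<and> (\<forall>x y. h (x + y) = h x + h y) \<and> (\<forall>x y. h (x * y) = h x * h y)"

text \<open>The target type is an extension field of the source type, of degree 2, via \<open>\<iota>\<close>.\<close>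

definition quadratic_extension :: "('a::field \<Rightarrow> 'b::field) \<Rightarrow> bool"
  where "quadratic_extension \<iota> \<longleftrightarrow>
    field_hom \<iota> \<and> vector_space.dim (\<lambda>c z. \<iota> c * z) (UNIV :: 'b set) = 2"

definition Gal :: "('a::field \<Rightarrow> 'b::field) \<Rightarrow> ('b \<Rightarrow> 'b) set"
  where "Gal \<iota> = {\<sigma>. field_hom \<sigma> \<and> bij \<sigma> \<and> (\<forall>c. \<sigma> (\<iota> c) = \<iota> c)}"

definition Gal_generator :: "('a::field \<Rightarrow> 'b::field) \<Rightarrow> ('b \<Rightarrow> 'b) \<Rightarrow> bool"
  where "Gal_generator \<iota> \<sigma> \<longleftrightarrow> \<sigma> \<in> Gal \<iota> \<and> Gal \<iota> = {\<sigma> ^^ n | n. True}"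

definition Im_star :: "('b::field \<Rightarrow> 'b) \<Rightarrow> 'b set"
  where "Im_star \<sigma> = {l. l \<noteq> 0 \<and> \<sigma> l = - l}"

text \<open>Coefficientwise application of a map of fields: base extension of forms along \<open>\<iota>\<close>, and
  conjugation of forms by \<open>\<sigma>\<close>.\<close>

definition map_form :: "('a::field \<Rightarrow> 'b::field) \<Rightarrow> 'a poly poly \<Rightarrow> 'b poly poly"
  where "map_form h = map_poly (map_poly h)"

definition map_matrix2 :: "('a::field \<Rightarrow> 'b::field) \<Rightarrow> 'a ^ 2 ^ 2 \<Rightarrow> 'b ^ 2 ^ 2"
  where "map_matrix2 h X = (\<chi> i j. h (X$i$j))"

section \<open>Basic facts\<close>

lemma xy_coeff_linear_form [simp]:
  "xy_coeff (linear_form a b) (Suc 0) 0 = a" "xy_coeff (linear_form a b) 0 (Suc 0) = b"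
  by (simp_all add: xy_coeff_def linear_form_def scal_def xform_def yform_def)

lemma Omega_linear_form: "Omega (linear_form a b) (linear_form a' b') = a * b' - b * a'"
  by (simp add: Omega_def)

lemma linear_form_add: "linear_form a b + linear_form c d = linear_form (a + c) (b + d)"
  by (simp add: linear_form_def scal_def xform_def yform_def)

lemma scal_linear_form: "scal s * linear_form a b = linear_form (s * a) (s * b)"
  by (simp add: linear_form_def scal_def xform_def yform_def)

lemma linear_form_eq_0_iff: "linear_form a b = 0 \<longleftrightarrow> a = 0 \<and> b = 0"
  by (auto simp add: linear_form_def scal_def xform_def yform_def)

lemma sl2_act_linear_form:
  "sl2_act X (linear_form a b) =
    linear_form (- a * X$1$1 - b * X$2$1) (- a * X$1$2 + b * X$1$1)"
  by (simp add: sl2_act_def scal_linear_form linear_form_add algebra_simps)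

lemma moment_cubic_form:
  assumes "(3 :: 'a::field) \<noteq> 0"
  shows "moment (cubic_form a b c d :: 'a poly poly) =
    vector [vector [a * d - b * c, 2 * (b * d - c\<^sup>2)],
            vector [2 * (b\<^sup>2 - a * c), - (a * d - b * c)]]"
  using assms
  by (simp add: moment_def cubic_form_def xy_coeff_def scal_def xform_def yform_def
      eval_nat_numeral Let_def)

lemma not_eigenvector_iff:
  assumes "v \<in> linear_forms" "v \<noteq> 0"
  shows "(\<nexists>l. eigenvector X l v) \<longleftrightarrow> Omega v (sl2_act X v) \<noteq> 0"
proof -
  obtain a b where v: "v = linear_form a b" using assms(1) by (auto simp: linear_forms_def)
  define p q where "p = - a * X$1$1 - b * X$2$1" and "q = - a * X$1$2 + b * X$1$1"
  have Xv: "sl2_act X v = linear_form p q" by (simp add: v sl2_act_linear_form p_def q_def)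
  have ab: "a \<noteq> 0 \<or> b \<noteq> 0" using assms(2) by (simp add: v linear_form_eq_0_iff)
  have "(\<exists>l. eigenvector X l v) \<longleftrightarrow> (\<exists>l. p = l * a \<and> q = l * b)"
  proof -
    have "linear_form p q = linear_form r s \<longleftrightarrow> p = r \<and> q = s" for r s
      by (metis xy_coeff_linear_form)
    then show ?thesis
      using assms unfolding eigenvector_def Xv by (simp add: v scal_linear_form)
  qed
  also have "\<dots> \<longleftrightarrow> a * q - b * p = 0"
  proof
    assume "a * q - b * p = 0"
    then show "\<exists>l. p = l * a \<and> q = l * b"
      using ab by (cases "a = 0")
        (auto simp: field_simps intro: exI[of _ "p / a"] exI[of _ "q / b"])
  qed (auto simp: algebra_simps)
  also have "a * q - b * p = Omega v (sl2_act X v)"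
    unfolding Xv by (simp add: v Omega_linear_form)
  finally show ?thesis by blast
qed

lemma kstar_mult:
  assumes "z \<in> kstar \<Delta>" "w \<in> kstar \<Delta>"
  shows "z * w \<in> kstar \<Delta>"
proof -
  obtain a b c d where "z = a\<^sup>2 + b\<^sup>2 * \<Delta>" "w = c\<^sup>2 + d\<^sup>2 * \<Delta>"
    using assms by (auto simp: kstar_def)
  then have "z * w = (a * c - b * d * \<Delta>)\<^sup>2 + (a * d + b * c)\<^sup>2 * \<Delta>"
    by (simp add: power2_eq_square algebra_simps)
  then show ?thesis using assms unfolding kstar_def by auto
qed

lemma kstar_inverse:
  assumes "z \<in> kstar \<Delta>"
  shows "inverse z \<in> kstar \<Delta>"
proof -
  obtain a b where z: "z = a\<^sup>2 + b\<^sup>2 * \<Delta>" "z \<noteq> 0"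
    using assms by (auto simp: kstar_def)
  have "inverse z = z / z\<^sup>2" using z(2) by (simp add: power2_eq_square divide_inverse)
  also have "\<dots> = (a / z)\<^sup>2 + (b / z)\<^sup>2 * \<Delta>"
    by (subst (1) z(1)) (simp add: power_divide add_divide_distrib)
  finally show ?thesis using z(2) unfolding kstar_def by auto
qed

lemma kstar_class_mult:
  assumes "w \<in> kstar \<Delta>"
  shows "kstar_class \<Delta> (z * w) = kstar_class \<Delta> z"
proof -
  have "u \<in> (\<lambda>t. w * t) ` kstar \<Delta>" if "u \<in> kstar \<Delta>" for u
  proof (rule image_eqI)
    show "u = w * (inverse w * u)" using assms by (simp add: kstar_def)
    show "inverse w * u \<in> kstar \<Delta>" using assms that by (intro kstar_mult kstar_inverse)
  qed
  then have "(\<lambda>t. w * t) ` kstar \<Delta> = kstar \<Delta>" using assms kstar_mult by blast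
  then have "(\<lambda>t. z * t) ` (\<lambda>t. w * t) ` kstar \<Delta> = (\<lambda>t. z * t) ` kstar \<Delta>" by simp
  then show ?thesis by (simp add: kstar_class_def image_image mult.assoc)
qed

lemma nu_eq:
  assumes X: "X \<in> sl2"
    and v: "v \<in> linear_forms" "v \<noteq> 0" "\<nexists>l. eigenvector X l v"
  shows "nu (det X) X = kstar_class (det X) (Omega v (sl2_act X v))"
proof -
  define w where "w = (SOME v. v \<in> linear_forms \<and> v \<noteq> 0 \<and> (\<nexists>l. eigenvector X l v))"
  have w: "w \<in> linear_forms" "w \<noteq> 0" "\<nexists>l. eigenvector X l w"
    using someI[of "\<lambda>v. v \<in> linear_forms \<and> v \<noteq> 0 \<and> (\<nexists>l. eigenvector X l v)" v] v
    unfolding w_def by blast+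
  obtain a b where vab: "v = linear_form a b" using v(1) by (auto simp: linear_forms_def)
  obtain c d where wcd: "w = linear_form c d" using w(1) by (auto simp: linear_forms_def)
  define p q where "p = - a * X$1$1 - b * X$2$1" and "q = - a * X$1$2 + b * X$1$1"
  define D where "D = Omega v (sl2_act X v)"
  define E where "E = Omega w (sl2_act X w)"
  have D: "D = a * q - b * p"
    by (simp add: D_def vab sl2_act_linear_form Omega_linear_form p_def q_def)
  have E: "E = c * (- c * X$1$2 + d * X$1$1) - d * (- c * X$1$1 - d * X$2$1)"
    by (simp add: E_def wcd sl2_act_linear_form Omega_linear_form)
  have D0: "D \<noteq> 0" using v not_eigenvector_iff unfolding D_def by blast
  have E0: "E \<noteq> 0" using w not_eigenvector_iff unfolding E_def by blast
  have X22: "X$2$2 = - (X$1$1)"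
    using X by (simp add: sl2_def trace_def sum_2 add_eq_0_iff)
  have det: "det X = - (X$1$1)\<^sup>2 - X$1$2 * X$2$1"
    by (simp add: det_2 X22 power2_eq_square)
  define s t where "s = (c * q - d * p) / D" and "t = (a * d - b * c) / D"
  have "D * E = (c * q - d * p)\<^sup>2 + (a * d - b * c)\<^sup>2 * det X"
    unfolding D E det p_def q_def by (simp add: power2_eq_square algebra_simps)
  also have "\<dots> = D\<^sup>2 * (s\<^sup>2 + t\<^sup>2 * det X)"
    using D0 by (simp add: s_def t_def power_divide distrib_left)
  finally have "E = D * (s\<^sup>2 + t\<^sup>2 * det X)"
    using D0 by (simp add: power2_eq_square mult.assoc)
  moreover from this E0 have "s\<^sup>2 + t\<^sup>2 * det X \<in> kstar (det X)"
    unfolding kstar_def by auto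
  ultimately have "kstar_class (det X) E = kstar_class (det X) D"
    using kstar_class_mult by metis
  then show ?thesis unfolding nu_def Let_def D_def E_def w_def .
qed

end

theory Submission
  imports Defs
begin

text \<open>
  Over the extension field the eigenvectors \<open>\<phi>\<close> and \<open>\<psi> = \<sigma> \<phi>\<close> of \<open>X\<close>, which belong to the distinct
  eigenvalues \<open>q\<close> and \<open>- q\<close>, form a basis of the linear forms. Put \<open>\<omega> = Omega \<psi> \<phi>\<close>; it is nonzero
  and \<open>\<sigma> \<omega> = - \<omega>\<close>.

  For existence of \<open>a\<close>, the form \<open>v = \<phi> + \<psi>\<close> is fixed by \<open>\<sigma>\<close>, hence defined over the base field, and
  \<open>Omega v (X v) = Omega (\<phi> + \<psi>) (q \<phi> - q \<psi>) = 2 q \<omega>\<close>. So \<open>\<nu>(X) = [2]\<close> says exactly that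
  \<open>q \<omega>\<close> has the shape \<open>c\<^sup>2 + d\<^sup>2 det X\<close>. As \<open>det X = - q\<^sup>2\<close>, this is the norm of
  \<open>m = c + d q\<close>. Since \<open>\<omega>\<^sup>2\<close> is fixed by \<open>\<sigma>\<close>, the element \<open>a = m / \<omega>\<^sup>2\<close> has norm \<open>q / \<omega>\<^sup>3\<close>
  (\<open>eigenvalue_times_Omega_is_norm\<close>).

  For the fibre, write a cubic as \<open>A \<phi>\<^sup>3 + 3 B \<phi>\<^sup>2 \<psi> + 3 C \<phi> \<psi>\<^sup>2 + D \<psi>\<^sup>3\<close>. The moment map is equivariant,
  so in the basis \<open>\<phi>, \<psi>\<close> its value is given by the same quadratic expressions in \<open>A, B, C, D\<close> as in the
  basis \<open>x, y\<close>, up to a power of \<open>\<omega>\<close> (\<open>sl2_act_moment_in_basis\<close>). It equals the diagonal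
  endomorphism with entries \<open>q, - q\<close> precisely when \<open>B = C = 0\<close> and \<open>A D \<omega>\<^sup>3 = q\<close>
  (\<open>moment_in_eigenbasis_eq_iff\<close>). Finally the cubic comes from the base field iff it is fixed by \<open>\<sigma>\<close>,
  which for \<open>B = C = 0\<close> means \<open>D = \<sigma> A\<close>. Thus the fibre consists of the forms
  \<open>A \<phi>\<^sup>3 + \<sigma> A \<psi>\<^sup>3\<close> where \<open>A\<close> has norm \<open>q / \<omega>\<^sup>3\<close>, and any two such \<open>A\<close> differ by a factor \<open>u\<close> of norm 1.
\<close>

section \<open>Homomorphisms of fields and base extension\<close>

lemma
  assumes "field_hom h"
  shows field_hom_one: "h 1 = 1"
    and field_hom_add: "h (x + y) = h x + h y"
    and field_hom_mult: "h (x * y) = h x * h y"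
  using assms by (simp_all add: field_hom_def)

lemma field_hom_zero:
  assumes "field_hom h" shows "h 0 = 0"
proof -
  have "h 0 + h 0 = h 0 + 0" by (simp flip: field_hom_add[OF assms])
  then show ?thesis by (simp only: add_left_cancel)
qed

lemma field_hom_minus:
  assumes "field_hom h" shows "h (- x) = - h x"
  using field_hom_add[OF assms, of x "- x"] field_hom_zero[OF assms]
  by (simp add: eq_neg_iff_add_eq_0 add.commute)

lemma field_hom_diff:
  assumes "field_hom h" shows "h (x - y) = h x - h y"
  using field_hom_add[OF assms, of x "- y"] field_hom_minus[OF assms] by simp

lemma field_hom_power:
  assumes "field_hom h" shows "h (x ^ n) = h x ^ n"
  by (induction n) (simp_all add: field_hom_one[OF assms] field_hom_mult[OF assms])

lemma field_hom_numeral: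
  assumes "field_hom h" shows "h (numeral n) = numeral n"
  by (induction n)
    (simp_all only: numeral.simps field_hom_one[OF assms] field_hom_add[OF assms])

lemmas field_hom_simps = field_hom_one field_hom_zero field_hom_add field_hom_mult
  field_hom_minus field_hom_diff field_hom_power field_hom_numeral

lemma field_hom_eq_iff:
  assumes "field_hom h" shows "h x = h y \<longleftrightarrow> x = y"
proof
  assume "h x = h y"
  then have "h (x - y) = 0" by (simp add: field_hom_diff[OF assms])
  then have "h ((x - y) * inverse (x - y)) = 0" by (simp add: field_hom_mult[OF assms])
  then show "x = y" using field_hom_one[OF assms] by (cases "x = y") auto
qed simp

lemma field_hom_divide:
  assumes "field_hom h" shows "h (x / y) = h x / h y"
proof (cases "y = 0")
  case False
  then have "h y \<noteq> 0" using field_hom_eq_iff[OF assms, of y 0] field_hom_zero[OF assms] by simp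
  moreover have "h (x / y) * h y = h x" using False field_hom_mult[OF assms, of "x / y" y] by simp
  ultimately show ?thesis by (simp add: field_simps)
qed (simp add: field_hom_zero[OF assms])

lemma linear_form_eq_pCons: "linear_form a b = [:[:0, a:], [:b:]:]"
  by (simp add: linear_form_def scal_def xform_def yform_def)

lemma cubic_form_eq_pCons:
  "cubic_form a b c d = [:[:0, 0, 0, a:], [:0, 0, 3 * b:], [:0, 3 * c:], [:d:]:]"
  by (simp add: cubic_form_def scal_def xform_def yform_def eval_nat_numeral)

lemma linear_form_eq_iff: "linear_form a b = linear_form c d \<longleftrightarrow> a = c \<and> b = d"
  by (simp add: linear_form_eq_pCons)

lemma map_form_linear_form:
  assumes "field_hom h"
  shows "map_form h (linear_form a b) = linear_form (h a) (h b)"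
  by (simp add: map_form_def linear_form_eq_pCons map_poly_pCons field_hom_zero[OF assms])

lemma map_form_cubic_form:
  assumes "field_hom h"
  shows "map_form h (cubic_form a b c d) = cubic_form (h a) (h b) (h c) (h d)"
  by (simp add: map_form_def cubic_form_eq_pCons map_poly_pCons field_hom_simps[OF assms])

lemma map_matrix2_eq_iff:
  assumes "field_hom h"
  shows "map_matrix2 h X = map_matrix2 h Y \<longleftrightarrow> X = Y"
  by (simp add: map_matrix2_def vec_eq_iff field_hom_eq_iff[OF assms])

lemma map_matrix2_moment:
  assumes "field_hom h" and "(3 :: 'a::field) \<noteq> 0" and "(3 :: 'b::field) \<noteq> 0"
  shows "map_matrix2 h (moment (cubic_form a b c d :: 'a poly poly)) =
    (moment (cubic_form (h a) (h b) (h c) (h d)) :: 'b ^ 2 ^ 2)"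
  by (simp add: moment_cubic_form assms vec_eq_iff forall_2 map_matrix2_def
      field_hom_simps[OF assms(1)])

section \<open>Cubic forms and the moment map in an arbitrary basis\<close>

definition cubic_in_basis :: "'a::field poly poly \<Rightarrow> 'a poly poly \<Rightarrow> 'a \<Rightarrow> 'a \<Rightarrow> 'a \<Rightarrow> 'a \<Rightarrow> 'a poly poly"
  where "cubic_in_basis p r A B C D =
    scal A * p ^ 3 + scal (3 * B) * p ^ 2 * r + scal (3 * C) * p * r ^ 2 + scal D * r ^ 3"

lemma scal_hom: "scal (a + b) = scal a + scal b" "scal (a * b) = scal a * scal b"
    "scal (- a) = - scal a" "scal (a - b) = scal a - scal b"
  by (simp_all add: scal_def)

lemma scal_const: "scal 0 = 0" "scal 1 = 1" "scal (numeral n) = numeral n"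
  by (simp_all add: scal_def numeral_poly flip: one_pCons)

lemma scal_power: "scal (a ^ n) = scal a ^ n"
  by (induction n) (simp_all add: scal_hom scal_const)

lemma cubic_in_basis_linear_forms:
  "cubic_in_basis (linear_form s t) (linear_form u v) A B C D = cubic_form
    (A * s ^ 3 + 3 * B * s\<^sup>2 * u + 3 * C * s * u\<^sup>2 + D * u ^ 3)
    (A * s\<^sup>2 * t + B * (s\<^sup>2 * v + 2 * s * t * u) + C * (2 * s * u * v + t * u\<^sup>2) + D * u\<^sup>2 * v)
    (A * s * t\<^sup>2 + B * (t\<^sup>2 * u + 2 * s * t * v) + C * (2 * t * u * v + s * v\<^sup>2) + D * u * v\<^sup>2)
    (A * t ^ 3 + 3 * B * t\<^sup>2 * v + 3 * C * t * v\<^sup>2 + D * v ^ 3)"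
  unfolding cubic_in_basis_def cubic_form_def linear_form_def scal_hom scal_power scal_const
  by algebra

text \<open>
  The inverse of the preceding substitution. With \<open>p = s x + t y\<close> and \<open>r = u x + v y\<close> one has
  \<open>\<delta> x = v p - t r\<close> and \<open>\<delta> y = - u p + s r\<close>, and the coefficients arise by inserting this. The outer two,
  the values of the cubic at \<open>(v, - u)\<close> and \<open>(- t, s)\<close> divided by \<open>\<delta>\<^sup>3\<close>, are needed explicitly: their
  shape shows that conjugation interchanges them when \<open>r\<close> is the conjugate of \<open>p\<close>.
\<close>

lemma cubic_form_in_basis:
  assumes \<delta>: "s * v - t * u = \<delta>" "\<delta> \<noteq> 0"
  shows "cubic_form a b c d = cubic_in_basis (linear_form s t) (linear_form u v)
    ((a * v ^ 3 - 3 * b * v\<^sup>2 * u + 3 * c * v * u\<^sup>2 - d * u ^ 3) / \<delta> ^ 3)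
    ((- a * v\<^sup>2 * t + b * (v\<^sup>2 * s + 2 * v * u * t) - c * (2 * u * v * s + u\<^sup>2 * t) + d * u\<^sup>2 * s) / \<delta> ^ 3)
    ((a * v * t\<^sup>2 - b * (t\<^sup>2 * u + 2 * s * t * v) + c * (2 * t * u * s + s\<^sup>2 * v) - d * u * s\<^sup>2) / \<delta> ^ 3)
    ((- a * t ^ 3 + 3 * b * t\<^sup>2 * s - 3 * c * t * s\<^sup>2 + d * s ^ 3) / \<delta> ^ 3)"
  (is "_ = cubic_in_basis _ _ (?A / _) (?B / _) (?C / _) (?D / _)")
proof -
  have cleared: "x = (?A / \<delta> ^ 3) * k + (?B / \<delta> ^ 3) * l + (?C / \<delta> ^ 3) * m + (?D / \<delta> ^ 3) * n"
    if "?A * k + ?B * l + ?C * m + ?D * n = x * (s * v - t * u) ^ 3" for x k l m n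
  proof -
    have "x = x * \<delta> ^ 3 / \<delta> ^ 3"
      using \<delta>(2) by simp
    also have "x * \<delta> ^ 3 = ?A * k + ?B * l + ?C * m + ?D * n"
      using that \<delta>(1) by simp
    also have "(A * k + B * l + C * m + D * n) / \<delta> ^ 3 =
        (A / \<delta> ^ 3) * k + (B / \<delta> ^ 3) * l + (C / \<delta> ^ 3) * m + (D / \<delta> ^ 3) * n" for A B C D
      by (simp add: add_divide_distrib)
    finally show ?thesis .
  qed
  have "a = (?A / \<delta> ^ 3) * s ^ 3 + (?B / \<delta> ^ 3) * (3 * s\<^sup>2 * u) + (?C / \<delta> ^ 3) * (3 * s * u\<^sup>2)
      + (?D / \<delta> ^ 3) * u ^ 3"
    by (rule cleared) algebra
  moreover have "b = (?A / \<delta> ^ 3) * (s\<^sup>2 * t) + (?B / \<delta> ^ 3) * (s\<^sup>2 * v + 2 * s * t * u)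
      + (?C / \<delta> ^ 3) * (2 * s * u * v + t * u\<^sup>2) + (?D / \<delta> ^ 3) * (u\<^sup>2 * v)"
    by (rule cleared) algebra
  moreover have "c = (?A / \<delta> ^ 3) * (s * t\<^sup>2) + (?B / \<delta> ^ 3) * (t\<^sup>2 * u + 2 * s * t * v)
      + (?C / \<delta> ^ 3) * (2 * t * u * v + s * v\<^sup>2) + (?D / \<delta> ^ 3) * (u * v\<^sup>2)"
    by (rule cleared) algebra
  moreover have "d = (?A / \<delta> ^ 3) * t ^ 3 + (?B / \<delta> ^ 3) * (3 * t\<^sup>2 * v) + (?C / \<delta> ^ 3) * (3 * t * v\<^sup>2)
      + (?D / \<delta> ^ 3) * v ^ 3"
    by (rule cleared) algebra
  ultimately show ?thesis
    unfolding cubic_in_basis_linear_forms by (simp only: ac_simps)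
qed

text \<open>
  Equivariance of the moment map in coordinates. In the basis \<open>p, r\<close> the moment of a cubic acts as the
  matrix of the standard formula does on \<open>x, y\<close>, times \<open>\<delta>\<^sup>3\<close> for \<open>\<delta> = Omega p r\<close>. The exponent is 3 because
  rescaling the basis by \<open>c\<close> multiplies the cubic by \<open>c\<^sup>3\<close>, hence its moment by \<open>c\<^sup>6\<close>, and \<open>\<delta>\<close> by \<open>c\<^sup>2\<close>.
\<close>

lemma sl2_act_moment_in_basis:
  fixes s t u v A B C D :: "'a::field"
  assumes "(3 :: 'a) \<noteq> 0"
  defines "p \<equiv> linear_form s t" and "r \<equiv> linear_form u v"
  defines "M \<equiv> moment (cubic_in_basis p r A B C D)"
  shows "sl2_act M p =
      scal (- (Omega p r ^ 3 * (A * D - B * C))) * p + scal (- (2 * Omega p r ^ 3 * (B * D - C\<^sup>2))) * r"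
    and "sl2_act M r =
      scal (- (2 * Omega p r ^ 3 * (B\<^sup>2 - A * C))) * p + scal (Omega p r ^ 3 * (A * D - B * C)) * r"
  unfolding M_def p_def r_def cubic_in_basis_linear_forms moment_cubic_form[OF assms(1)]
    sl2_act_linear_form Omega_linear_form scal_linear_form linear_form_add linear_form_eq_iff
  by (simp_all, algebra+)

lemma moment_in_sl2: "moment f \<in> sl2"
  by (simp add: sl2_def trace_def sum_2 moment_def Let_def)

lemma linear_form_combination_eq_iff:
  assumes "Omega (linear_form s t) (linear_form u v) \<noteq> 0"
  shows "scal a * linear_form s t + scal b * linear_form u v =
    scal c * linear_form s t + scal d * linear_form u v \<longleftrightarrow> a = c \<and> b = d"
proof
  assume "scal a * linear_form s t + scal b * linear_form u v =
    scal c * linear_form s t + scal d * linear_form u v"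
  then have "a * s + b * u = c * s + d * u" "a * t + b * v = c * t + d * v"
    by (simp_all add: scal_linear_form linear_form_add linear_form_eq_iff)
  then have "(a - c) * (s * v - t * u) = 0" "(b - d) * (s * v - t * u) = 0"
    by algebra+
  then show "a = c \<and> b = d" using assms by (simp add: Omega_linear_form)
qed simp

lemma sl2_eqI:
  assumes "M \<in> sl2" "N \<in> sl2"
    and "Omega (linear_form s t) (linear_form u v) \<noteq> 0"
    and "sl2_act M (linear_form s t) = sl2_act N (linear_form s t)"
    and "sl2_act M (linear_form u v) = sl2_act N (linear_form u v)"
  shows "M = N"
proof -
  let ?\<delta> = "s * v - t * u"
  have eqs: "- s * M$1$1 - t * M$2$1 = - s * N$1$1 - t * N$2$1"
    "- s * M$1$2 + t * M$1$1 = - s * N$1$2 + t * N$1$1"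
    "- u * M$1$1 - v * M$2$1 = - u * N$1$1 - v * N$2$1"
    "- u * M$1$2 + v * M$1$1 = - u * N$1$2 + v * N$1$1"
    using assms(4,5) unfolding sl2_act_linear_form linear_form_eq_iff by auto
  have "?\<delta> * (M$1$1 - N$1$1) = 0" "?\<delta> * (M$2$1 - N$2$1) = 0" using eqs(1,3) by algebra+
  moreover have "?\<delta> * (M$1$2 - N$1$2) = 0" using eqs(2,4) by algebra
  ultimately have "M$1$1 = N$1$1" "M$1$2 = N$1$2" "M$2$1 = N$2$1"
    using assms(3) by (simp_all add: Omega_linear_form)
  moreover have "M$2$2 = - M$1$1" "N$2$2 = - N$1$1"
    using assms(1,2) by (simp_all add: sl2_def trace_def sum_2 eq_neg_iff_add_eq_0 add.commute)
  ultimately show ?thesis by (simp add: vec_eq_iff forall_2)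
qed

section \<open>Eigenvectors and the fibre in an eigenbasis\<close>

lemma eigenvector_linear_form_iff:
  "eigenvector M l (linear_form s t) \<longleftrightarrow> (s \<noteq> 0 \<or> t \<noteq> 0) \<and>
    - s * M$1$1 - t * M$2$1 = l * s \<and> - s * M$1$2 + t * M$1$1 = l * t"
  by (auto simp: eigenvector_def linear_forms_def linear_form_eq_0_iff sl2_act_linear_form
      scal_linear_form linear_form_eq_iff)

lemma eigenvalue_square:
  assumes "M \<in> sl2" "eigenvector M l v"
  shows "l\<^sup>2 = - det M"
proof -
  obtain s t where v: "v = linear_form s t"
    using assms(2) by (auto simp: eigenvector_def linear_forms_def)
  have st: "s \<noteq> 0 \<or> t \<noteq> 0" and eqs: "- s * M$1$1 - t * M$2$1 = l * s" "- s * M$1$2 + t * M$1$1 = l * t"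
    using assms(2) unfolding v eigenvector_linear_form_iff by auto
  have M22: "M$2$2 = - M$1$1"
    using assms(1) by (simp add: sl2_def trace_def sum_2 eq_neg_iff_add_eq_0 add.commute)
  have "(l\<^sup>2 - ((M$1$1)\<^sup>2 + M$1$2 * M$2$1)) * s = 0" "(l\<^sup>2 - ((M$1$1)\<^sup>2 + M$1$2 * M$2$1)) * t = 0"
    using eqs by algebra+
  then have "l\<^sup>2 = (M$1$1)\<^sup>2 + M$1$2 * M$2$1" using st by auto
  then show ?thesis by (simp add: det_2 M22 power2_eq_square)
qed

lemma Omega_eigenvectors_nonzero:
  fixes q :: "'a::field"
  assumes "(2 :: 'a) \<noteq> 0" "q \<noteq> 0"
    and "eigenvector M q (linear_form s t)" "eigenvector M (- q) (linear_form u v)"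
  shows "Omega (linear_form s t) (linear_form u v) \<noteq> 0"
proof
  assume "Omega (linear_form s t) (linear_form u v) = 0"
  then have dep: "s * v = t * u" by (simp add: Omega_linear_form)
  have eqs: "s \<noteq> 0 \<or> t \<noteq> 0" "u \<noteq> 0 \<or> v \<noteq> 0"
    "- s * M$1$1 - t * M$2$1 = q * s" "- s * M$1$2 + t * M$1$1 = q * t"
    "- u * M$1$1 - v * M$2$1 = - q * u" "- u * M$1$2 + v * M$1$1 = - q * v"
    using assms(3,4) unfolding eigenvector_linear_form_iff by auto
  have "2 * q * (s * u) = 0" using eqs(3,5) dep by algebra
  moreover have "2 * q * (t * v) = 0" using eqs(4,6) dep by algebra
  ultimately have "s = 0 \<or> u = 0" "t = 0 \<or> v = 0" using assms(1,2) by auto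
  then show False using dep eqs(1,2) by auto
qed

text \<open>
  The description of the fibre over a split semisimple element. Vanishing of the off-diagonal entries
  reads \<open>B D = C\<^sup>2\<close> and \<open>B\<^sup>2 = A C\<close>; these relations make \<open>B\<close> and \<open>C\<close> annihilate \<open>A D - B C\<close>, which is
  nonzero as it is \<open>q\<close> up to a unit. Hence only the two pure cubes survive.
\<close>

lemma moment_in_eigenbasis_eq_iff:
  fixes q :: "'a::field"
  assumes char: "(2 :: 'a) \<noteq> 0" "(3 :: 'a) \<noteq> 0" and q: "q \<noteq> 0" and M: "M \<in> sl2"
    and p: "p = linear_form s t" and r: "r = linear_form u v"
    and eig: "eigenvector M q p" "eigenvector M (- q) r"
  shows "moment (cubic_in_basis p r A B C D) = M \<longleftrightarrow> B = 0 \<and> C = 0 \<and> A * D * Omega r p ^ 3 = q"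
proof -
  define N where "N = moment (cubic_in_basis p r A B C D)"
  define \<delta> where "\<delta> = Omega p r"
  have \<delta>0: "\<delta> \<noteq> 0"
    unfolding \<delta>_def p r using Omega_eigenvectors_nonzero char(1) q eig p r by blast
  have swap: "Omega r p ^ 3 = - (\<delta> ^ 3)"
  proof -
    have "Omega r p = - \<delta>" by (simp add: \<delta>_def p r Omega_linear_form algebra_simps)
    then show ?thesis by simp
  qed
  have actM: "sl2_act M p = scal q * p + scal 0 * r" "sl2_act M r = scal 0 * p + scal (- q) * r"
    using eig by (simp_all add: eigenvector_def scal_const)
  have actN: "sl2_act N p = scal (- (\<delta> ^ 3 * (A * D - B * C))) * p + scal (- (2 * \<delta> ^ 3 * (B * D - C\<^sup>2))) * r"
    "sl2_act N r = scal (- (2 * \<delta> ^ 3 * (B\<^sup>2 - A * C))) * p + scal (\<delta> ^ 3 * (A * D - B * C)) * r"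
    unfolding N_def \<delta>_def p r by (rule sl2_act_moment_in_basis[OF char(2)])+
  have "N = M \<longleftrightarrow> sl2_act N p = sl2_act M p \<and> sl2_act N r = sl2_act M r"
    using sl2_eqI[of N M s t u v] \<delta>0 M moment_in_sl2 unfolding p r \<delta>_def N_def by auto
  also have "\<dots> \<longleftrightarrow> - (\<delta> ^ 3 * (A * D - B * C)) = q \<and> B * D = C\<^sup>2 \<and> B\<^sup>2 = A * C"
    using \<delta>0 char(1) unfolding actM actN unfolding \<delta>_def p r
    by (subst (1 2) linear_form_combination_eq_iff) auto
  also have "\<dots> \<longleftrightarrow> B = 0 \<and> C = 0 \<and> A * D * Omega r p ^ 3 = q"
  proof (intro iffI conjI)
    assume *: "- (\<delta> ^ 3 * (A * D - B * C)) = q \<and> B * D = C\<^sup>2 \<and> B\<^sup>2 = A * C"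
    then have "A * D - B * C \<noteq> 0" using q by auto
    moreover have "B * D = C\<^sup>2" "B\<^sup>2 = A * C" using * by auto
    then have "B * (A * D - B * C) = 0" "C * (A * D - B * C) = 0" by algebra+
    ultimately show "B = 0" "C = 0" by auto
    then show "A * D * Omega r p ^ 3 = q" using * by (simp add: swap mult.commute)
  qed (auto simp: swap mult.commute)
  finally show ?thesis unfolding N_def .
qed

section \<open>Conjugation in a quadratic extension\<close>

text \<open>
  The elements 1 and \<open>w\<close> are linearly independent, so in dimension 2 they span: a further element
  outside their span would give three independent vectors inside the span of a two-element basis.
\<close>

lemma quadratic_extension_decompose:
  assumes "quadratic_extension \<iota>" "w \<notin> range \<iota>"
  obtains x y where "z = \<iota> x + \<iota> y * w"
proof -
  have hom: "field_hom \<iota>" and dim: "vector_space.dim (\<lambda>c z. \<iota> c * z) (UNIV :: 'b set) = 2"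
    using assms(1) by (auto simp: quadratic_extension_def)
  interpret vs: vector_space "\<lambda>c z. \<iota> c * z"
    by unfold_locales (simp_all add: field_hom_simps[OF hom] algebra_simps)
  obtain B where B: "vs.independent B" "UNIV \<subseteq> vs.span B" "card B = 2"
    using vs.basis_exists[of UNIV] dim by auto
  then have finB: "finite B" using card.infinite by fastforce
  have span1: "u \<in> vs.span {1} \<longleftrightarrow> u \<in> range \<iota>" for u
    by (auto simp: vs.span_singleton)
  have "1 \<noteq> w" using assms(2) field_hom_one[OF hom] by (metis rangeI)
  then have indep: "vs.independent {w, 1}"
    using assms(2) span1 by (auto simp: vs.independent_insert)
  have "z \<in> vs.span {w, 1}"
  proof (rule ccontr)
    assume z: "z \<notin> vs.span {w, 1}"
    then have "vs.independent {z, w, 1}" using indep by (rule vs.independent_insertI)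
    then have "card {z, w, 1} \<le> card B"
      using vs.independent_span_bound[OF finB] B(2) by blast
    moreover have "z \<noteq> w" "z \<noteq> 1" using z vs.span_base[of _ "{w, 1}"] by auto
    ultimately show False using \<open>1 \<noteq> w\<close> B(3) by auto
  qed
  then obtain y where "z - \<iota> y * w \<in> range \<iota>"
    using span1 by (auto simp: vs.span_insert)
  then obtain x where "z - \<iota> y * w = \<iota> x" by auto
  then have "z = \<iota> x + \<iota> y * w" by (simp add: algebra_simps)
  then show thesis by (rule that)
qed

text \<open>
  An imaginary element serves as the second basis vector, because \<open>\<sigma>\<close> fixes the base field and
  moves \<open>q\<close> to \<open>- q\<close>. In this basis \<open>\<sigma>\<close> is the usual conjugation, so its being an involution and
  its fixed field can be read off.
\<close>

lemma conjugation_decompose: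
  fixes \<sigma> :: "'l::field \<Rightarrow> 'l"
  assumes "quadratic_extension \<iota>" "\<sigma> \<in> Gal \<iota>" "q \<in> Im_star \<sigma>" "(2 :: 'l) \<noteq> 0"
  obtains x y where "z = \<iota> x + \<iota> y * q" "\<sigma> z = \<iota> x - \<iota> y * q"
proof -
  have hom: "field_hom \<sigma>" and base: "\<sigma> (\<iota> c) = \<iota> c" for c
    using assms(2) by (auto simp: Gal_def)
  have q: "q \<noteq> 0" "\<sigma> q = - q" using assms(3) by (auto simp: Im_star_def)
  have "q \<notin> range \<iota>"
  proof
    assume "q \<in> range \<iota>"
    then have "2 * q = 0" using base q(2) by (metis add.right_inverse mult_2 rangeE)
    then show False using q(1) assms(4) by simp
  qed
  then obtain x y where z: "z = \<iota> x + \<iota> y * q"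
    using quadratic_extension_decompose[OF assms(1)] by blast
  then have "\<sigma> z = \<iota> x - \<iota> y * q" by (simp add: field_hom_simps[OF hom] base q(2))
  with z show thesis by (rule that)
qed

lemma conjugation_fixed_iff:
  fixes \<sigma> :: "'l::field \<Rightarrow> 'l"
  assumes "quadratic_extension \<iota>" "\<sigma> \<in> Gal \<iota>" "q \<in> Im_star \<sigma>" "(2 :: 'l) \<noteq> 0"
  shows "\<sigma> z = z \<longleftrightarrow> z \<in> range \<iota>"
proof
  obtain x y where z: "z = \<iota> x + \<iota> y * q" "\<sigma> z = \<iota> x - \<iota> y * q"
    using conjugation_decompose[OF assms] .
  assume "\<sigma> z = z"
  then have "\<iota> x + \<iota> y * q = \<iota> x - \<iota> y * q" using z by simp
  then have "2 * (\<iota> y * q) = 0" by algebra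
  then have "\<iota> y * q = 0" using assms(4) by simp
  then show "z \<in> range \<iota>" using z(1) by (metis add.right_neutral rangeI)
qed (use assms(2) in \<open>auto simp: Gal_def\<close>)

lemma conjugation_involution:
  fixes \<sigma> :: "'l::field \<Rightarrow> 'l"
  assumes "quadratic_extension \<iota>" "\<sigma> \<in> Gal \<iota>" "q \<in> Im_star \<sigma>" "(2 :: 'l) \<noteq> 0"
  shows "\<sigma> (\<sigma> z) = z"
proof -
  obtain x y where z: "z = \<iota> x + \<iota> y * q" "\<sigma> z = \<iota> x - \<iota> y * q"
    using conjugation_decompose[OF assms] .
  have "\<sigma> (\<iota> x - \<iota> y * q) = \<iota> x + \<iota> y * q"
    using assms(2,3) by (auto simp: Gal_def Im_star_def field_hom_simps)
  then show ?thesis using z by simp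
qed

section \<open>The invariant as a norm condition\<close>

text \<open>
  The test vector for \<open>\<nu>\<close> is \<open>\<phi> + \<psi>\<close>, the trace of the eigenvector. It lies over the base field and gives
  the value \<open>2 q Omega \<psi> \<phi>\<close>, so the class \<open>[2]\<close> leaves \<open>q Omega \<psi> \<phi>\<close> in \<open>kstar (det X)\<close>, which consists
  of norms because \<open>det X = - q\<^sup>2\<close>.
\<close>

lemma eigenvalue_times_Omega_is_norm:
  fixes \<iota> :: "'k::field \<Rightarrow> 'l::field" and \<sigma> :: "'l \<Rightarrow> 'l"
  assumes ext: "quadratic_extension \<iota>" and \<sigma>: "\<sigma> \<in> Gal \<iota>" and q: "q \<in> Im_star \<sigma>"
    and two: "(2 :: 'k) \<noteq> 0" "(2 :: 'l) \<noteq> 0" and X: "X \<in> sl2"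
    and nu: "nu (det X) X = kstar_class (det X) 2"
    and \<phi>: "\<phi> = linear_form \<alpha> \<beta>" and \<psi>: "\<psi> = linear_form (\<sigma> \<alpha>) (\<sigma> \<beta>)"
    and eig: "eigenvector (map_matrix2 \<iota> X) q \<phi>" "eigenvector (map_matrix2 \<iota> X) (- q) \<psi>"
  obtains m where "m * \<sigma> m = q * Omega \<psi> \<phi>"
proof -
  let ?Y = "map_matrix2 \<iota> X"
  have hom: "field_hom \<iota>" "field_hom \<sigma>" and base: "\<sigma> (\<iota> c) = \<iota> c" for c
    using ext \<sigma> by (auto simp: quadratic_extension_def Gal_def)
  note fixed = conjugation_fixed_iff[OF ext \<sigma> q two(2)]
    and invol = conjugation_involution[OF ext \<sigma> q two(2)]
  have q0: "q \<noteq> 0" "\<sigma> q = - q" using q by (auto simp: Im_star_def)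
  have \<omega>0: "Omega \<psi> \<phi> \<noteq> 0"
    using Omega_eigenvectors_nonzero[OF two(2) q0(1)] eig unfolding \<phi> \<psi> Omega_linear_form
    by (metis eq_iff_diff_eq_0 mult.commute)
  \<comment> \<open>The linear form with coefficients \<open>a\<close> and \<open>b\<close> is \<open>\<phi> + \<psi>\<close>, descended to the base field.\<close>
  have "\<alpha> + \<sigma> \<alpha> \<in> range \<iota>" "\<beta> + \<sigma> \<beta> \<in> range \<iota>"
    by (simp_all add: field_hom_add[OF hom(2)] invol add.commute flip: fixed)
  then obtain a b where ab: "\<iota> a = \<alpha> + \<sigma> \<alpha>" "\<iota> b = \<beta> + \<sigma> \<beta>" by (metis rangeE)
  define v where "v = linear_form a b"
  have "\<iota> (Omega v (sl2_act X v)) =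
      Omega (linear_form (\<iota> a) (\<iota> b)) (sl2_act ?Y (linear_form (\<iota> a) (\<iota> b)))"
    by (simp add: v_def sl2_act_linear_form Omega_linear_form field_hom_simps[OF hom(1)] map_matrix2_def)
  also have "\<dots> = 2 * q * Omega \<psi> \<phi>"
  proof -
    have "- \<alpha> * ?Y$1$1 - \<beta> * ?Y$2$1 = q * \<alpha>" "- \<alpha> * ?Y$1$2 + \<beta> * ?Y$1$1 = q * \<beta>"
      "- \<sigma> \<alpha> * ?Y$1$1 - \<sigma> \<beta> * ?Y$2$1 = - q * \<sigma> \<alpha>" "- \<sigma> \<alpha> * ?Y$1$2 + \<sigma> \<beta> * ?Y$1$1 = - q * \<sigma> \<beta>"
      using eig unfolding \<phi> \<psi> eigenvector_linear_form_iff by auto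
    then show ?thesis
      unfolding ab \<phi> \<psi> sl2_act_linear_form Omega_linear_form by algebra
  qed
  finally have Omega_v: "\<iota> (Omega v (sl2_act X v)) = 2 * q * Omega \<psi> \<phi>" .
  then have "Omega v (sl2_act X v) \<noteq> 0"
    using q0 \<omega>0 two field_hom_zero[OF hom(1)] by force
  moreover from this have "v \<in> linear_forms" "v \<noteq> 0"
    by (auto simp: v_def linear_forms_def Omega_def xy_coeff_def)
  ultimately have "nu (det X) X = kstar_class (det X) (Omega v (sl2_act X v))"
    using nu_eq[OF X] not_eigenvector_iff by blast
  moreover have "1 \<in> kstar (det X)"
  proof -
    have one: "1 = 1\<^sup>2 + 0\<^sup>2 * det X" by simp
    show ?thesis unfolding kstar_def by (intro CollectI conjI exI one_neq_zero) (fact one)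
  qed
  ultimately have "Omega v (sl2_act X v) \<in> kstar_class (det X) 2"
    using nu unfolding kstar_class_def by force
  then obtain c d where "Omega v (sl2_act X v) = 2 * (c\<^sup>2 + d\<^sup>2 * det X)"
    by (auto simp: kstar_class_def kstar_def)
  then have "2 * (q * Omega \<psi> \<phi>) = 2 * ((\<iota> c)\<^sup>2 + (\<iota> d)\<^sup>2 * \<iota> (det X))"
    using Omega_v by (simp add: field_hom_simps[OF hom(1)] mult.assoc)
  then have "q * Omega \<psi> \<phi> = (\<iota> c)\<^sup>2 + (\<iota> d)\<^sup>2 * \<iota> (det X)"
    using two(2) by (simp only: mult_left_cancel not_False_eq_True)
  moreover have "\<iota> (det X) = - q\<^sup>2"
  proof -
    have "?Y \<in> sl2"
      using X by (simp add: sl2_def trace_def sum_2 map_matrix2_def field_hom_zero[OF hom(1)]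
          flip: field_hom_add[OF hom(1)])
    from eigenvalue_square[OF this eig(1)] show ?thesis
      by (simp add: det_2 map_matrix2_def field_hom_simps[OF hom(1)])
  qed
  ultimately have "(\<iota> c + \<iota> d * q) * (\<iota> c - \<iota> d * q) = q * Omega \<psi> \<phi>"
    by (simp add: algebra_simps power2_eq_square)
  moreover have "\<sigma> (\<iota> c + \<iota> d * q) = \<iota> c - \<iota> d * q"
    by (simp add: field_hom_simps[OF hom(2)] base q0)
  ultimately show thesis using that by metis
qed

section \<open>The fibre of the moment map\<close>

lemma of_nat_prime_nonzero:
  assumes "CHAR('a::field) \<noteq> n" "prime n"
  shows "(of_nat n :: 'a) \<noteq> 0"
  using assms by (auto simp: of_nat_eq_0_iff_char_dvd prime_nat_iff)

theorem proposition3p42: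
  fixes \<iota> :: "'k::field \<Rightarrow> 'l::field" and \<sigma> :: "'l \<Rightarrow> 'l"
    and X :: "'k ^ 2 ^ 2" and q :: 'l and \<phi> :: "'l poly poly"
  assumes "CHAR('k) \<noteq> 2" and "CHAR('k) \<noteq> 3"
    and "quadratic_extension \<iota>" and "Gal_generator \<iota> \<sigma>"
    and "X \<in> sl2"
    and "\<iota> (- det X) \<in> {r\<^sup>2 | r. r \<in> Im_star \<sigma>}"
    and "nu (det X) X = kstar_class (det X) 2"
    and "q \<in> Im_star \<sigma>"
    and "eigenvector (map_matrix2 \<iota> X) q \<phi>"
    and "eigenvector (map_matrix2 \<iota> X) (\<sigma> q) (map_form \<sigma> \<phi>)"
  shows "(\<exists>a. a \<noteq> 0 \<and> a * \<sigma> a * Omega (map_form \<sigma> \<phi>) \<phi> ^ 3 = q) \<and>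
    (\<forall>a. a \<noteq> 0 \<and> a * \<sigma> a * Omega (map_form \<sigma> \<phi>) \<phi> ^ 3 = q \<longrightarrow>
      map_form \<iota> ` {f \<in> cubic_forms. moment f = X} =
        {scal (u * a) * \<phi> ^ 3 + scal (\<sigma> u * \<sigma> a) * map_form \<sigma> \<phi> ^ 3 | u. u \<noteq> 0 \<and> u * \<sigma> u = 1})"
proof -
  have ext: "quadratic_extension \<iota>" and \<sigma>: "\<sigma> \<in> Gal \<iota>" and q: "q \<in> Im_star \<sigma>"
    using assms by (auto simp: Gal_generator_def)
  have hom: "field_hom \<iota>" "field_hom \<sigma>" and base: "\<sigma> (\<iota> c) = \<iota> c" for c
    using ext \<sigma> by (auto simp: quadratic_extension_def Gal_def)
  have two: "(2 :: 'k) \<noteq> 0" and three: "(3 :: 'k) \<noteq> 0"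
    using of_nat_prime_nonzero[OF assms(1)] of_nat_prime_nonzero[OF assms(2)] by simp_all
  have "\<iota> 2 \<noteq> \<iota> 0" "\<iota> 3 \<noteq> \<iota> 0"
    using two three by (simp_all only: field_hom_eq_iff[OF hom(1)] not_False_eq_True)
  then have two': "(2 :: 'l) \<noteq> 0" and three': "(3 :: 'l) \<noteq> 0"
    by (simp_all add: field_hom_simps[OF hom(1)])
  note fixed = conjugation_fixed_iff[OF ext \<sigma> q two']
    and invol = conjugation_involution[OF ext \<sigma> q two']
  have q0: "q \<noteq> 0" "\<sigma> q = - q" using q by (auto simp: Im_star_def)
  define \<psi> where "\<psi> = map_form \<sigma> \<phi>"
  obtain \<alpha> \<beta> where \<phi>: "\<phi> = linear_form \<alpha> \<beta>"
    using assms(9) by (auto simp: eigenvector_def linear_forms_def)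
  have \<psi>: "\<psi> = linear_form (\<sigma> \<alpha>) (\<sigma> \<beta>)"
    by (simp add: \<psi>_def \<phi> map_form_linear_form[OF hom(2)])
  have eig: "eigenvector (map_matrix2 \<iota> X) q \<phi>" "eigenvector (map_matrix2 \<iota> X) (- q) \<psi>"
    using assms(9,10) by (simp_all add: \<psi>_def q0)
  have Y: "map_matrix2 \<iota> X \<in> sl2"
    using assms(5) by (simp add: sl2_def trace_def sum_2 map_matrix2_def field_hom_zero[OF hom(1)]
        flip: field_hom_add[OF hom(1)])
  define \<delta> where "\<delta> = \<alpha> * \<sigma> \<beta> - \<beta> * \<sigma> \<alpha>"
  define \<omega> where "\<omega> = Omega \<psi> \<phi>"
  have \<omega>\<delta>: "\<omega> = - \<delta>" by (simp add: \<omega>_def \<delta>_def \<phi> \<psi> Omega_linear_form algebra_simps)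
  have \<delta>0: "\<delta> \<noteq> 0"
    using Omega_eigenvectors_nonzero[OF two' q0(1)] eig unfolding \<phi> \<psi> Omega_linear_form \<delta>_def by blast
  have \<sigma>\<delta>: "\<sigma> \<delta> = - \<delta>"
    by (simp add: \<delta>_def field_hom_simps[OF hom(2)] invol algebra_simps)
  note moment_iff = moment_in_eigenbasis_eq_iff[OF two' three' q0(1) Y \<phi> \<psi> eig, folded \<omega>_def]

  have "\<exists>a. a \<noteq> 0 \<and> a * \<sigma> a * \<omega> ^ 3 = q"
  proof -
    obtain m where m: "m * \<sigma> m = q * \<omega>"
      using eigenvalue_times_Omega_is_norm[OF ext \<sigma> q two two' assms(5,7) \<phi> \<psi> eig]
      unfolding \<omega>_def by blast
    have "\<sigma> (\<omega>\<^sup>2) = \<omega>\<^sup>2" by (simp add: field_hom_simps[OF hom(2)] \<omega>\<delta> \<sigma>\<delta>)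
    then have "(m / \<omega>\<^sup>2) * \<sigma> (m / \<omega>\<^sup>2) * \<omega> ^ 3 = (m * \<sigma> m) / (\<omega>\<^sup>2 * \<omega>\<^sup>2) * \<omega> ^ 3"
      by (simp add: field_hom_divide[OF hom(2)])
    also have "\<dots> = q"
      using \<delta>0 by (simp add: m \<omega>\<delta> field_simps eval_nat_numeral)
    finally show ?thesis using q0(1) by (metis mult_zero_left)
  qed
  moreover have "map_form \<iota> ` {f \<in> cubic_forms. moment f = X} =
      {scal (u * a) * \<phi> ^ 3 + scal (\<sigma> u * \<sigma> a) * \<psi> ^ 3 | u. u \<noteq> 0 \<and> u * \<sigma> u = 1}"
    (is "_ = ?R") if a: "a \<noteq> 0" "a * \<sigma> a * \<omega> ^ 3 = q" for a
  proof (intro equalityI subsetI)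
    fix F assume "F \<in> map_form \<iota> ` {f \<in> cubic_forms. moment f = X}"
    then obtain c0 c1 c2 c3 where mom: "moment (cubic_form c0 c1 c2 c3) = X"
      and "F = map_form \<iota> (cubic_form c0 c1 c2 c3)"
      by (auto simp: cubic_forms_def)
    then have F: "F = cubic_form (\<iota> c0) (\<iota> c1) (\<iota> c2) (\<iota> c3)"
      by (simp add: map_form_cubic_form[OF hom(1)])
    \<comment> \<open>The coefficient of \<open>\<phi>\<^sup>3\<close> from \<open>cubic_form_in_basis\<close>. Conjugating it swaps \<open>\<alpha>, \<beta>\<close> with their
      conjugates and changes the sign of \<open>\<delta>\<close>, which yields the coefficient of \<open>\<psi>\<^sup>3\<close>.\<close>
    define A where "A = (\<iota> c0 * \<sigma> \<beta> ^ 3 - 3 * \<iota> c1 * (\<sigma> \<beta>)\<^sup>2 * \<sigma> \<alpha>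
      + 3 * \<iota> c2 * \<sigma> \<beta> * (\<sigma> \<alpha>)\<^sup>2 - \<iota> c3 * \<sigma> \<alpha> ^ 3) / \<delta> ^ 3"
    have "\<sigma> A = (\<iota> c0 * \<beta> ^ 3 - 3 * \<iota> c1 * \<beta>\<^sup>2 * \<alpha> + 3 * \<iota> c2 * \<beta> * \<alpha>\<^sup>2 - \<iota> c3 * \<alpha> ^ 3) / (- \<delta>) ^ 3"
      by (simp only: A_def field_hom_divide[OF hom(2)] field_hom_simps[OF hom(2)] base invol \<sigma>\<delta>)
    also have "\<dots> = (- \<iota> c0 * \<beta> ^ 3 + 3 * \<iota> c1 * \<beta>\<^sup>2 * \<alpha> - 3 * \<iota> c2 * \<beta> * \<alpha>\<^sup>2 + \<iota> c3 * \<alpha> ^ 3) / \<delta> ^ 3"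
      using \<delta>0 by (simp add: field_simps)
    finally have "\<sigma> A = \<dots>" .
    then obtain B C where basis: "F = cubic_in_basis \<phi> \<psi> A B C (\<sigma> A)"
      unfolding F \<phi> \<psi> A_def using cubic_form_in_basis[OF \<delta>_def[symmetric] \<delta>0] by metis
    have "moment F = map_matrix2 \<iota> X"
      unfolding F by (simp add: map_matrix2_moment[OF hom(1) three three'] flip: mom)
    then have A: "B = 0" "C = 0" "A * \<sigma> A * \<omega> ^ 3 = q"
      unfolding basis moment_iff by auto
    define u where "u = A / a"
    have "u * \<sigma> u = (A * \<sigma> A * \<omega> ^ 3) / (a * \<sigma> a * \<omega> ^ 3)"
      using \<delta>0 by (simp add: u_def field_hom_divide[OF hom(2)] \<omega>\<delta>)
    then have "u * \<sigma> u = 1" using A(3) a(2) q0(1) by simp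
    moreover from this have "u \<noteq> 0" by auto
    moreover have "u * a = A" using a(1) by (simp add: u_def)
    moreover from this have "\<sigma> u * \<sigma> a = \<sigma> A" by (simp flip: field_hom_mult[OF hom(2)])
    moreover have "F = scal A * \<phi> ^ 3 + scal (\<sigma> A) * \<psi> ^ 3"
      by (simp add: basis A(1,2) cubic_in_basis_def scal_const)
    ultimately show "F \<in> ?R" by force
  next
    fix F assume "F \<in> ?R"
    then obtain u where u: "u * \<sigma> u = 1"
      and "F = scal (u * a) * \<phi> ^ 3 + scal (\<sigma> u * \<sigma> a) * \<psi> ^ 3"
      by auto
    define A where "A = u * a"
    have F: "F = cubic_in_basis \<phi> \<psi> A 0 0 (\<sigma> A)"
      using \<open>F = _\<close> by (simp add: A_def cubic_in_basis_def scal_const field_hom_mult[OF hom(2)])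
    have "A * \<sigma> A * \<omega> ^ 3 = (u * \<sigma> u) * (a * \<sigma> a * \<omega> ^ 3)"
      by (simp add: A_def field_hom_mult[OF hom(2)])
    then have "A * \<sigma> A * \<omega> ^ 3 = q" by (simp add: u a)
    then have mom: "moment F = map_matrix2 \<iota> X" unfolding F moment_iff by simp
    \<comment> \<open>Each coefficient of \<open>F\<close> is a sum of two conjugate elements, so \<open>F\<close> descends.\<close>
    have "A * \<alpha> ^ 3 + \<sigma> A * \<sigma> \<alpha> ^ 3 \<in> range \<iota>"
      "A * \<alpha>\<^sup>2 * \<beta> + \<sigma> A * (\<sigma> \<alpha>)\<^sup>2 * \<sigma> \<beta> \<in> range \<iota>"
      "A * \<alpha> * \<beta>\<^sup>2 + \<sigma> A * \<sigma> \<alpha> * (\<sigma> \<beta>)\<^sup>2 \<in> range \<iota>"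
      "A * \<beta> ^ 3 + \<sigma> A * \<sigma> \<beta> ^ 3 \<in> range \<iota>"
      by (simp_all add: field_hom_simps[OF hom(2)] invol add.commute flip: fixed)
    then obtain c0 c1 c2 c3 where
      "A * \<alpha> ^ 3 + \<sigma> A * \<sigma> \<alpha> ^ 3 = \<iota> c0"
      "A * \<alpha>\<^sup>2 * \<beta> + \<sigma> A * (\<sigma> \<alpha>)\<^sup>2 * \<sigma> \<beta> = \<iota> c1"
      "A * \<alpha> * \<beta>\<^sup>2 + \<sigma> A * \<sigma> \<alpha> * (\<sigma> \<beta>)\<^sup>2 = \<iota> c2"
      "A * \<beta> ^ 3 + \<sigma> A * \<sigma> \<beta> ^ 3 = \<iota> c3"
      by blast
    then have F': "F = cubic_form (\<iota> c0) (\<iota> c1) (\<iota> c2) (\<iota> c3)"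
      by (simp add: F \<phi> \<psi> cubic_in_basis_linear_forms)
    then have "map_matrix2 \<iota> (moment (cubic_form c0 c1 c2 c3)) = map_matrix2 \<iota> X"
      using mom by (simp add: map_matrix2_moment[OF hom(1) three three'])
    then have "moment (cubic_form c0 c1 c2 c3) = X"
      by (simp add: map_matrix2_eq_iff[OF hom(1)])
    then have "cubic_form c0 c1 c2 c3 \<in> {f \<in> cubic_forms. moment f = X}"
      by (auto simp: cubic_forms_def)
    moreover have "F = map_form \<iota> (cubic_form c0 c1 c2 c3)"
      by (simp add: F' map_form_cubic_form[OF hom(1)])
    ultimately show "F \<in> map_form \<iota> ` {f \<in> cubic_forms. moment f = X}"
      by blast
  qed
  ultimately show ?thesis unfolding \<omega>_def \<psi>_def by blast
qed

end
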